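(* Fix $p \in (0,1)$ (a constant independent of $n$). The following property holds asymptotically almost surely for $G = (V,E) \in \mathcal{G}(n,p)$: $$ \mathrm{pq}(G) \le \mathrm{eq}(G) \le k := \frac {3}{p^2 (1-p)^2} \log n = O \left( \log n \right). $$
   Context: Query game on a simple graph $G=(V,E)$: $d_G(u,v)$ denotes the graph distance. An adversary fixes a target vertex $v^*\in V$ unknown to an adaptive algorithm. In each round the algorithm queries two vertices $u,v$, and the adversary replies with whichever of $u,v$ is closer to $v^*$ (with either one, at the adversary's choice, if $d_G(u,v^* )=d_G(v,v^* )$). Equivalently: put $V_0=V$; in round $t$ the algorithm presents $(u_t,v_t)$ (depending on $G$ and earlier replies) and the adversary chooses either $V_t=\{x\in V_{t-1}: d_G(u_t,x)\le d_G(v_t,x)\}$ (reply $u_t$) or $V_t=\{x\in V_{t-1}: d_G(v_t,x)\le d_G(u_t,x)\}$ (reply $v_t$); the target is located once $|V_t|=1$. A pair query allows arbitrary $u,v\in V$; an edge query requires $u$ and $v$ to be adjacent. $\mathrm{pq}(G)$ (respectively $\mathrm{eq}(G)$) is the least integer $t$ such that the algorithm can locate the target in at most $t$ pair queries (respectively edge queries), regardless of the strategy of the adversary. $\mathcal{G}(n,p)$ is the binomial random graph on vertex set $\{1,\dots,n\}$, each pair being an edge independently with probability $p$. A property holds asymptotically almost surely (a.a.s.) if its probability tends to $1$ as $n\to\infty$. $\log$ is the natural logarithm. Expressions that have to be integers (such as $k$) are rounded up or down without specifying which. *)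

theory Defs
  imports
    "HOL-Probability.Probability"
    "HOL-Library.Landau_Symbols"
    "HOL-Library.Extended_Nat"
begin

text \<open>
  A simple graph is a pair of a vertex set and a set of edges, each edge being a two-element set
  of vertices.
\<close>

type_synonym 'a graph = "'a set \<times> 'a set set"

abbreviation verts :: "'a graph \<Rightarrow> 'a set" where "verts G \<equiv> fst G"
abbreviation edges :: "'a graph \<Rightarrow> 'a set set" where "edges G \<equiv> snd G"

definition simple_graph :: "'a graph \<Rightarrow> bool" where
  "simple_graph G \<longleftrightarrow> edges G \<subseteq> {e. e \<subseteq> verts G \<and> card e = 2}"

definition walk :: "'a graph \<Rightarrow> 'a \<Rightarrow> 'a list \<Rightarrow> 'a \<Rightarrow> bool" where
  "walk G u ws v \<longleftrightarrow> ws \<noteq> [] \<and> hd ws = u \<and> last ws = v \<and> set ws \<subseteq> verts G \<and>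
     successively (\<lambda>x y. {x, y} \<in> edges G) ws"

text \<open>The distance is \<open>\<infinity>\<close> between vertices of different components.\<close>

definition gdist :: "'a graph \<Rightarrow> 'a \<Rightarrow> 'a \<Rightarrow> enat" where
  "gdist G u v = (INF ws \<in> {ws. walk G u ws v}. enat (length ws - 1))"

text \<open>
  An adaptive algorithm maps the list of the replies received so far (oldest first) to its next
  query. The predicate below says that \<open>rs\<close> is a legal sequence of replies to the algorithm \<open>\<sigma>\<close> by
  an adversary whose target is \<open>x\<close>. When both queried vertices are equally far from \<open>x\<close>, either
  reply is legal.
\<close>

type_synonym 'a algorithm = "'a list \<Rightarrow> 'a \<times> 'a"

definition consistent_replies :: "'a graph \<Rightarrow> 'a algorithm \<Rightarrow> 'a \<Rightarrow> 'a list \<Rightarrow> bool" where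
  "consistent_replies G \<sigma> x rs \<longleftrightarrow>
     (\<forall>i < length rs. case \<sigma> (take i rs) of (u, v) \<Rightarrow>
        rs ! i = u \<and> gdist G u x \<le> gdist G v x \<or>
        rs ! i = v \<and> gdist G v x \<le> gdist G u x)"

text \<open>The set \<open>V\<^sub>t\<close> of vertices that can still be the target after the \<open>t\<close> replies \<open>rs\<close>.\<close>

definition candidates :: "'a graph \<Rightarrow> 'a algorithm \<Rightarrow> 'a list \<Rightarrow> 'a set" where
  "candidates G \<sigma> rs = {x \<in> verts G. consistent_replies G \<sigma> x rs}"

text \<open>
  Some algorithm locates every target in at most \<open>t\<close> queries: in every position reachable within \<open>t\<close>
  rounds, either the target is located, or rounds remain and the next query is an allowed one. The
  candidate sets shrink along a play and always contain the target, so a located target remains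
  located, and nothing is required of the queries made after that.
\<close>

definition locatable_within :: "('a \<times> 'a) set \<Rightarrow> 'a graph \<Rightarrow> nat \<Rightarrow> bool" where
  "locatable_within Q G t \<longleftrightarrow>
     (\<exists>\<sigma>. \<forall>x \<in> verts G. \<forall>rs. length rs \<le> t \<and> consistent_replies G \<sigma> x rs \<longrightarrow>
        card (candidates G \<sigma> rs) = 1 \<or> (length rs < t \<and> \<sigma> rs \<in> Q))"

text \<open>
  The least sufficient number of queries; it is \<open>\<infinity>\<close> if no number suffices, which happens, for
  example, for edge queries in an edgeless graph with at least two vertices.
\<close>

definition query_number :: "('a \<times> 'a) set \<Rightarrow> 'a graph \<Rightarrow> enat" where
  "query_number Q G = (INF t \<in> {t. locatable_within Q G t}. enat t)"

definition pair_queries :: "'a graph \<Rightarrow> ('a \<times> 'a) set" where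
  "pair_queries G = verts G \<times> verts G"

definition edge_queries :: "'a graph \<Rightarrow> ('a \<times> 'a) set" where
  "edge_queries G = {(u, v) \<in> verts G \<times> verts G. {u, v} \<in> edges G}"

definition pq :: "'a graph \<Rightarrow> enat" where
  "pq G = query_number (pair_queries G) G"

definition eq :: "'a graph \<Rightarrow> enat" where
  "eq G = query_number (edge_queries G) G"

definition vertex_pairs :: "nat \<Rightarrow> nat set set" where
  "vertex_pairs n = {e. e \<subseteq> {1..n} \<and> card e = 2}"

definition gnp :: "nat \<Rightarrow> real \<Rightarrow> nat graph pmf" where
  "gnp n p = map_pmf (\<lambda>f. ({1..n}, {e \<in> vertex_pairs n. f e}))
     (Pi_pmf (vertex_pairs n) False (\<lambda>_. bernoulli_pmf p))"

lemma simple_graph_gnp: "G \<in> set_pmf (gnp n p) \<Longrightarrow> verts G = {1..n} \<and> simple_graph G"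
  by (auto simp del: atLeastAtMost_iff simp: gnp_def simple_graph_def vertex_pairs_def)

definition asymp_almost_surely :: "(nat \<Rightarrow> 'b pmf) \<Rightarrow> (nat \<Rightarrow> 'b \<Rightarrow> bool) \<Rightarrow> bool" where
  "asymp_almost_surely M P \<longleftrightarrow> (\<lambda>n. measure_pmf.prob (M n) {\<omega>. P n \<omega>}) \<longlonglongrightarrow> 1"

end

theory Submission
  imports Defs "HOL-Real_Asymp.Real_Asymp"
begin

text \<open>
  Let \<open>q = p\<^sup>2 (1 - p)\<^sup>2\<close>. Take \<open>m \<approx> (5/2) log n / (p q)\<close> disjoint pairs \<open>{u, v}\<close> of vertices and query
  those that are edges. By Hoeffding's inequality there are a.a.s. at most
  \<open>(5/2) log n / q + (1/2) log n / q = k\<close> of them. If \<open>u\<close> is adjacent to \<open>x\<close> but not to \<open>y\<close>, and \<open>v\<close> is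
  adjacent to \<open>y\<close> but not to \<open>x\<close>, then no reply to the query \<open>(u, v)\<close> is legal for both targets \<open>x\<close>
  and \<open>y\<close>. A pair disjoint from \<open>{x, y}\<close> is an edge with this property with probability \<open>p q\<close>,
  independently for different pairs, so that all pairs fail with probability at most
  \<open>(1 - p q)\<^bsup>m - 2\<^esup> = O(n\<^bsup>-5/2\<^esup>)\<close>. A union bound over the fewer than \<open>n\<^sup>2\<close> choices of \<open>(x, y)\<close> shows that
  a.a.s. these non-adaptive queries distinguish any two vertices.
\<close>

section \<open>Non-adaptive strategies\<close>

text \<open>The \<open>i\<close>-th query is the \<open>i\<close>-th entry of \<open>qs\<close>,
  whatever the replies. If two targets survived the whole list, the query separating them would have
  been answered by \<open>u\<close> for one and by \<open>v\<close> for the other; the strict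
  inequalities force \<open>u\<close> and \<open>v\<close> to differ.\<close>

lemma locatable_within_nonadaptive:
  assumes "verts G \<noteq> {}"
    and "set qs \<subseteq> Q"
    and sep: "\<And>x y. x \<in> verts G \<Longrightarrow> y \<in> verts G \<Longrightarrow> x \<noteq> y \<Longrightarrow>
      \<exists>(u, v) \<in> set qs. gdist G u x < gdist G v x \<and> gdist G v y < gdist G u y"
  shows "locatable_within Q G (length qs)"
  unfolding locatable_within_def
\<comment> \<open>The strategy looks only at the number of replies. Past the end of
  \<open>qs\<close> its value is unspecified, but there the target is already located.\<close>
proof (intro exI[of _ "\<lambda>rs. qs ! length rs"] ballI allI impI)
  fix x rs
  assume x: "x \<in> verts G"
    and rs: "length rs \<le> length qs \<and> consistent_replies G (\<lambda>rs. qs ! length rs) x rs"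
  show "card (candidates G (\<lambda>rs. qs ! length rs) rs) = 1 \<or>
    (length rs < length qs \<and> qs ! length rs \<in> Q)"
  proof (cases "length rs < length qs")
    case True
    then show ?thesis using assms(2) nth_mem by blast
  next
    case False
    have "candidates G (\<lambda>rs. qs ! length rs) rs = {x}"
    proof (rule ccontr)
      assume "candidates G (\<lambda>rs. qs ! length rs) rs \<noteq> {x}"
      moreover have "x \<in> candidates G (\<lambda>rs. qs ! length rs) rs"
        using x rs by (simp add: candidates_def)
      ultimately obtain y where y: "y \<noteq> x" "y \<in> candidates G (\<lambda>rs. qs ! length rs) rs"
        by blast
      with sep[of x y] x obtain u v where uv: "(u, v) \<in> set qs"
        "gdist G u x < gdist G v x" "gdist G v y < gdist G u y"
        by (auto simp: candidates_def)
      then obtain i where i: "i < length rs" "qs ! i = (u, v)"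
        using False by (metis in_set_conv_nth less_le_trans linorder_not_less)
      \<comment> \<open>\<open>take i rs\<close> has length \<open>i\<close>, so round
        \<open>i\<close> asks \<open>qs ! i\<close>, and the same reply \<open>rs ! i\<close> must
        be legal for every surviving target \<open>z\<close>.\<close>
      have *: "rs ! i = u \<and> gdist G u z \<le> gdist G v z \<or> rs ! i = v \<and> gdist G v z \<le> gdist G u z"
        if "consistent_replies G (\<lambda>rs. qs ! length rs) z rs" for z
        using that i unfolding consistent_replies_def by (auto dest!: spec[of _ i])
      have "rs ! i = u" using *[of x] rs uv by auto
      moreover have "rs ! i = v" using *[of y] y uv by (auto simp: candidates_def)
      ultimately show False using uv by auto
    qed
    then show ?thesis by simp
  qed
qed

lemma query_number_antimono:
  assumes "Q \<subseteq> Q'"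
  shows "query_number Q' G \<le> query_number Q G"
proof -
  have "locatable_within Q' G t" if "locatable_within Q G t" for t
    using that assms unfolding locatable_within_def by (meson subsetD)
  then show ?thesis
    unfolding query_number_def by (intro INF_superset_mono) auto
qed

lemma pq_le_eq: "pq G \<le> eq G"
  unfolding pq_def eq_def
  by (rule query_number_antimono) (auto simp: edge_queries_def pair_queries_def)

lemma query_number_le: "locatable_within Q G t \<Longrightarrow> query_number Q G \<le> enat t"
  unfolding query_number_def by (intro INF_lower) auto

section \<open>Distances at most one and at least two\<close>

lemma gdist_le_1:
  assumes "{u, x} \<in> edges G" "u \<in> verts G" "x \<in> verts G"
  shows "gdist G u x \<le> 1"
proof -
  have "gdist G u x \<le> enat (length [u, x] - 1)"
    unfolding gdist_def using assms by (intro INF_lower) (auto simp: walk_def)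
  then show ?thesis by (simp add: one_enat_def)
qed

lemma gdist_ge_2:
  assumes "{v, x} \<notin> edges G" "v \<noteq> x"
  shows "2 \<le> gdist G v x"
  unfolding gdist_def
proof (rule INF_greatest)
  fix ws assume "ws \<in> {ws. walk G v ws x}"
  then have w: "walk G v ws x" by simp
  \<comment> \<open>A walk on one vertex would give \<open>v = x\<close>, a walk on two vertices an
    edge \<open>{v, x}\<close>.\<close>
  have "length ws \<ge> 3"
  proof (cases ws)
    case (Cons a as)
    then show ?thesis using w assms by (cases as; cases "tl as") (auto simp: walk_def)
  qed (use w in \<open>auto simp: walk_def\<close>)
  then have "enat 2 \<le> enat (length ws - 1)" by simp
  then show "2 \<le> enat (length ws - 1)" by (simp add: numeral_eq_enat)
qed

text \<open>The sets that decide \<open>separates f u v x y\<close>. Disjoint blocks make the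
  corresponding events independent.\<close>

definition block :: "'a \<Rightarrow> 'a \<Rightarrow> 'a \<Rightarrow> 'a \<Rightarrow> 'a set set" where
  "block u v x y = {{u, v}, {u, x}, {v, y}, {v, x}, {u, y}}"

text \<open>Stated for a predicate on sets because the random object is the indicator of the edge
  set. The first conjunct makes \<open>(u, v)\<close> an edge query; the other four make
  \<open>u\<close> closer to \<open>x\<close> and \<open>v\<close> closer to
  \<open>y\<close>.\<close>

definition separates :: "('a set \<Rightarrow> bool) \<Rightarrow> 'a \<Rightarrow> 'a \<Rightarrow> 'a \<Rightarrow> 'a \<Rightarrow> bool" where
  "separates f u v x y \<longleftrightarrow> f {u, v} \<and> f {u, x} \<and> f {v, y} \<and> \<not> f {v, x} \<and> \<not> f {u, y}"

lemma gdist_less_if_separates: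
  assumes "separates (\<lambda>e. e \<in> edges G) u v x y" "{u, v, x, y} \<subseteq> verts G" "x \<noteq> v" "y \<noteq> u"
  shows "gdist G u x < gdist G v x" "gdist G v y < gdist G u y"
proof -
  have *: "a < b" if "a \<le> 1" "2 \<le> b" for a b :: enat
    using that by (cases a; cases b) (auto simp: one_enat_def numeral_eq_enat)
  show "gdist G u x < gdist G v x" "gdist G v y < gdist G u y"
    using assms gdist_le_1[of u x G] gdist_ge_2[of v x G] gdist_le_1[of v y G] gdist_ge_2[of u y G]
    by (auto simp: separates_def intro!: *)
qed

section \<open>Independence in product distributions\<close>

text \<open>Mapping \<open>(a, b)\<close> to \<open>(P a, Q b)\<close> turns the event into a single
  point, and point masses of a product multiply.\<close>

lemma prob_pair_pmf_conj:
  "measure_pmf.prob (pair_pmf M N) {(a, b). P a \<and> Q b} =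
     measure_pmf.prob M {a. P a} * measure_pmf.prob N {b. Q b}"
proof -
  have "measure_pmf.prob (pair_pmf M N) {(a, b). P a \<and> Q b} =
      pmf (map_pmf (\<lambda>(a, b). (P a, Q b)) (pair_pmf M N)) (True, True)"
    unfolding pmf_map by (rule arg_cong[where f = "measure_pmf.prob _"]) auto
  also have "\<dots> = pmf (map_pmf P M) True * pmf (map_pmf Q N) True"
    by (simp add: map_pair pmf_pair)
  also have "\<dots> = measure_pmf.prob M {a. P a} * measure_pmf.prob N {b. Q b}"
    by (simp add: pmf_map vimage_def)
  finally show ?thesis .
qed

text \<open>\<open>P\<close> sees only the coordinates in \<open>B\<close> and \<open>Q\<close> only
  those outside. The product distribution is glued from independent parts on \<open>B\<close> and
  \<open>A - B\<close>.\<close>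

lemma prob_Pi_pmf_conj:
  assumes "finite A" "B \<subseteq> A"
    and P: "\<And>f g. (\<And>e. e \<in> B \<Longrightarrow> f e = g e) \<Longrightarrow> P f = P g"
    and Q: "\<And>f g. (\<And>e. e \<notin> B \<Longrightarrow> f e = g e) \<Longrightarrow> Q f = Q g"
  shows "measure_pmf.prob (Pi_pmf A d p) {f. P f \<and> Q f} =
    measure_pmf.prob (Pi_pmf A d p) {f. P f} * measure_pmf.prob (Pi_pmf A d p) {f. Q f}"
proof -
  let ?M = "Pi_pmf B d p" and ?N = "Pi_pmf (A - B) d p"
  have fin: "finite B" using assms finite_subset by blast
  have *: "measure_pmf.prob (Pi_pmf A d p) {f. P' f \<and> Q' f} =
      measure_pmf.prob ?M {f. P' f} * measure_pmf.prob ?N {f. Q' f}"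
    if P': "\<And>f g. (\<And>e. e \<in> B \<Longrightarrow> f e = g e) \<Longrightarrow> P' f = P' g"
      and Q': "\<And>f g. (\<And>e. e \<notin> B \<Longrightarrow> f e = g e) \<Longrightarrow> Q' f = Q' g" for P' Q'
  proof -
    have "Pi_pmf A d p = Pi_pmf (B \<union> (A - B)) d p"
      using assms(2) by (simp add: Un_absorb1)
    also have "\<dots> = map_pmf (\<lambda>(f, g) x. if x \<in> B then f x else g x) (pair_pmf ?M ?N)"
      using assms(1) fin by (intro Pi_pmf_union) auto
    finally have "measure_pmf.prob (Pi_pmf A d p) {f. P' f \<and> Q' f} =
      measure_pmf.prob (pair_pmf ?M ?N)
        {(f, g). P' (\<lambda>x. if x \<in> B then f x else g x) \<and> Q' (\<lambda>x. if x \<in> B then f x else g x)}"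
      by (simp add: vimage_def case_prod_unfold)
    also have "{(f, g). P' (\<lambda>x. if x \<in> B then f x else g x) \<and> Q' (\<lambda>x. if x \<in> B then f x else g x)} =
      {(f, g). P' f \<and> Q' g}"
    proof -
      have "P' (\<lambda>x. if x \<in> B then f x else g x) = P' f" for f g by (rule P') simp
      moreover have "Q' (\<lambda>x. if x \<in> B then f x else g x) = Q' g" for f g by (rule Q') simp
      ultimately show ?thesis by simp
    qed
    finally show ?thesis by (simp only: prob_pair_pmf_conj)
  qed
  show ?thesis
  proof -
    have "measure_pmf.prob (Pi_pmf A d p) {f. P f \<and> Q f} =
        measure_pmf.prob ?M {f. P f} * measure_pmf.prob ?N {f. Q f}"
      by (rule *) (rule P, assumption, rule Q, assumption)
    \<comment> \<open>Putting the trivial event for \<open>Q\<close>, then for \<open>P\<close>,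
      identifies the probabilities in the two parts with those over all of \<open>A\<close>.\<close>
    moreover have "measure_pmf.prob (Pi_pmf A d p) {f. P f \<and> True} =
        measure_pmf.prob ?M {f. P f} * measure_pmf.prob ?N {f. True}"
      by (rule *) (rule P, assumption, simp)
    moreover have "measure_pmf.prob (Pi_pmf A d p) {f. True \<and> Q f} =
        measure_pmf.prob ?M {f. True} * measure_pmf.prob ?N {f. Q f}"
      by (rule *) (simp, rule Q, assumption)
    ultimately show ?thesis by simp
  qed
qed

text \<open>Induction on \<open>I\<close>: the remaining events ignore the coordinates in
  \<open>B i\<close>, hence are independent of the new one.\<close>

lemma prob_Pi_pmf_Ball_not:
  fixes p :: "'a \<Rightarrow> 'b pmf"
  assumes "finite A" "finite I"
    and "\<And>i. i \<in> I \<Longrightarrow> B i \<subseteq> A"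
    and "\<And>i j. i \<in> I \<Longrightarrow> j \<in> I \<Longrightarrow> i \<noteq> j \<Longrightarrow> B i \<inter> B j = {}"
    and "\<And>i f g. i \<in> I \<Longrightarrow> (\<And>e. e \<in> B i \<Longrightarrow> f e = g e) \<Longrightarrow> P i f = P i g"
  shows "measure_pmf.prob (Pi_pmf A d p) {f. \<forall>i\<in>I. \<not> P i f} =
    (\<Prod>i\<in>I. 1 - measure_pmf.prob (Pi_pmf A d p) {f. P i f})"
  using assms(2-5)
proof (induction I)
  case (insert i I)
  have "measure_pmf.prob (Pi_pmf A d p) {f. \<not> P i f \<and> (\<forall>j\<in>I. \<not> P j f)} =
      measure_pmf.prob (Pi_pmf A d p) {f. \<not> P i f} *
      measure_pmf.prob (Pi_pmf A d p) {f. \<forall>j\<in>I. \<not> P j f}"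
  proof (rule prob_Pi_pmf_conj[of A "B i"])
    show "B i \<subseteq> A" using insert.prems by auto
    show "(\<not> P i f) = (\<not> P i g)" if "\<And>e. e \<in> B i \<Longrightarrow> f e = g e" for f g
      using insert.prems(3)[of i f g] that by auto
    show "(\<forall>j\<in>I. \<not> P j f) = (\<forall>j\<in>I. \<not> P j g)" if "\<And>e. e \<notin> B i \<Longrightarrow> f e = g e" for f g
    proof -
      have "P j f = P j g" if "j \<in> I" for j
      proof (rule insert.prems(3))
        have "B i \<inter> B j = {}" using insert.hyps that by (intro insert.prems(2)) auto
        then show "f e = g e" if "e \<in> B j" for e
          using that \<open>\<And>e. e \<notin> B i \<Longrightarrow> f e = g e\<close> by blast
      qed (use that in auto)
      then show ?thesis by auto
    qed
  qed fact
  moreover have "measure_pmf.prob (Pi_pmf A d p) {f. \<not> P i f} =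
      1 - measure_pmf.prob (Pi_pmf A d p) {f. P i f}"
    using measure_pmf.prob_compl[of "{f. P i f}" "Pi_pmf A d p"]
    by (simp add: Compl_eq_Diff_UNIV[symmetric] Collect_neg_eq)
  moreover have "measure_pmf.prob (Pi_pmf A d p) {f. \<forall>j\<in>I. \<not> P j f} =
      (\<Prod>j\<in>I. 1 - measure_pmf.prob (Pi_pmf A d p) {f. P j f})"
  proof (rule insert.IH)
    show "B j \<subseteq> A" if "j \<in> I" for j
      using insert.prems(1) that by simp
    show "B j \<inter> B k = {}" if "j \<in> I" "k \<in> I" "j \<noteq> k" for j k
      using insert.prems(2) that by simp
    show "P j f = P j g" if "j \<in> I" "\<And>e. e \<in> B j \<Longrightarrow> f e = g e" for j f g
      by (rule insert.prems(3)) (use that in auto)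
  qed
  ultimately show ?case using insert.hyps by simp
qed simp

lemma prob_Pi_bernoulli_cylinder:
  assumes "finite A" "T \<subseteq> A" "F \<subseteq> A" "T \<inter> F = {}" "0 \<le> p" "p \<le> 1"
  shows "measure_pmf.prob (Pi_pmf A d (\<lambda>_. bernoulli_pmf p)) {f. (\<forall>e\<in>T. f e) \<and> (\<forall>e\<in>F. \<not> f e)} =
    p ^ card T * (1 - p) ^ card F"
proof -
  \<comment> \<open>Unconstrained coordinates get \<open>UNIV\<close> and contribute the factor 1,
    so the product over \<open>A\<close> shrinks to \<open>T\<close> and \<open>F\<close>.\<close>
  let ?B = "\<lambda>e. if e \<in> T then {True} else if e \<in> F then {False} else UNIV"
  let ?b = "\<lambda>e. measure_pmf.prob (bernoulli_pmf p) (?B e)"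
  have fin: "finite T" "finite F" using assms finite_subset by blast+
  have "{f. (\<forall>e\<in>T. f e) \<and> (\<forall>e\<in>F. \<not> f e)} = Pi A ?B"
    using assms by (fastforce simp: Pi_def split: if_splits)
  then have "measure_pmf.prob (Pi_pmf A d (\<lambda>_. bernoulli_pmf p))
      {f. (\<forall>e\<in>T. f e) \<and> (\<forall>e\<in>F. \<not> f e)} = (\<Prod>e\<in>A. ?b e)"
    using assms(1) by (simp add: measure_Pi_pmf_Pi)
  also have "\<dots> = (\<Prod>e\<in>T \<union> F. ?b e)"
    using assms by (intro prod.mono_neutral_right) auto
  also have "\<dots> = (\<Prod>e\<in>T. ?b e) * (\<Prod>e\<in>F. ?b e)"
    using fin assms by (intro prod.union_disjoint) auto
  also have "(\<Prod>e\<in>T. ?b e) = (\<Prod>e\<in>T. p)"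
    using assms by (intro prod.cong) (auto simp: measure_pmf_single)
  also have "(\<Prod>e\<in>F. ?b e) = (\<Prod>e\<in>F. 1 - p)"
    using assms by (intro prod.cong) (auto simp: measure_pmf_single)
  finally show ?thesis by simp
qed

section \<open>Random graphs\<close>

lemma finite_vertex_pairs [simp]: "finite (vertex_pairs n)"
  unfolding vertex_pairs_def by (rule finite_subset[of _ "Pow {1..n}"]) auto

lemma doubleton_in_vertex_pairs:
  "{u, v} \<in> vertex_pairs n \<longleftrightarrow> u \<noteq> v \<and> u \<in> {1..n} \<and> v \<in> {1..n}"
  by (auto simp: vertex_pairs_def card_insert_if)

lemma prob_gnp:
  "measure_pmf.prob (gnp n p) {G. P G} =
   measure_pmf.prob (Pi_pmf (vertex_pairs n) False (\<lambda>_. bernoulli_pmf p))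
     {f. P ({1..n}, {e \<in> vertex_pairs n. f e})}"
  by (simp add: gnp_def vimage_def)

text \<open>Three prescribed edges and two prescribed non-edges; distinctness of the four vertices
  makes these five pairs distinct.\<close>

lemma prob_separates:
  assumes "0 \<le> p" "p \<le> 1" "{u, v, x, y} \<subseteq> {1..n}" "distinct [u, v, x, y]"
  shows "measure_pmf.prob (Pi_pmf (vertex_pairs n) False (\<lambda>_. bernoulli_pmf p))
    {f. separates f u v x y} = p ^ 3 * (1 - p) ^ 2"
proof -
  let ?T = "{{u, v}, {u, x}, {v, y}}" and ?F = "{{v, x}, {u, y}}"
  have "{f. separates f u v x y} = {f. (\<forall>e\<in>?T. f e) \<and> (\<forall>e\<in>?F. \<not> f e)}"
    by (auto simp: separates_def)
  moreover have "measure_pmf.prob (Pi_pmf (vertex_pairs n) False (\<lambda>_. bernoulli_pmf p)) \<dots> =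
      p ^ card ?T * (1 - p) ^ card ?F"
    using assms by (intro prob_Pi_bernoulli_cylinder)
      (auto simp: doubleton_in_vertex_pairs doubleton_eq_iff)
  moreover have "card ?T = 3" "card ?F = 2"
    using assms by (auto simp: card_insert_if doubleton_eq_iff)
  ultimately show ?thesis by simp
qed

text \<open>At least \<open>m - 2\<close> of the disjoint pairs \<open>{2*i+1, 2*i+2}\<close> avoid
  \<open>x\<close> and \<open>y\<close>. Their blocks are disjoint, so the probabilities of failure
  multiply.\<close>

lemma prob_no_separating_pair:
  fixes m n :: nat and p :: real
  assumes p: "0 \<le> p" "p \<le> 1" and "2 * m \<le> n" and xy: "x \<in> {1..n}" "y \<in> {1..n}" "x \<noteq> y"
  shows "measure_pmf.prob (Pi_pmf (vertex_pairs n) False (\<lambda>_. bernoulli_pmf p))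
    {f. \<forall>i<m. {2*i+1, 2*i+2} \<inter> {x, y} = {} \<longrightarrow> \<not> separates f (2*i+1) (2*i+2) x y}
    \<le> (1 - p ^ 3 * (1 - p) ^ 2) ^ (m - 2)"
proof -
  let ?M = "Pi_pmf (vertex_pairs n) False (\<lambda>_. bernoulli_pmf p)"
  define I where "I = {i. i < m \<and> {2*i+1, 2*i+2} \<inter> {x, y} = {}}"
  have [simp]: "finite I" by (simp add: I_def)
  \<comment> \<open>Vertex \<open>x\<close> can lie only in the pair with index
    \<open>(x-1) div 2\<close>, so \<open>x\<close> and \<open>y\<close> each spoil at most one
    index.\<close>
  have "{..<m} - {(x-1) div 2, (y-1) div 2} \<subseteq> I" by (auto simp: I_def)
  then have "card ({..<m} - {(x-1) div 2, (y-1) div 2}) \<le> card I"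
    by (intro card_mono) auto
  moreover have "m - 2 \<le> card ({..<m} - {(x-1) div 2, (y-1) div 2})"
    using diff_card_le_card_Diff[of "{(x-1) div 2, (y-1) div 2}" "{..<m}"]
      card_insert_le_m1[of 2 "{(y-1) div 2}" "(x-1) div 2"]
      diff_le_mono2[of "card {(x-1) div 2, (y-1) div 2}" 2 m] by simp
  ultimately have card: "m - 2 \<le> card I" by simp
  have sub: "{2*i+1, 2*i+2, x, y} \<subseteq> {1..n}" "distinct [2*i+1, 2*i+2, x, y]" if "i \<in> I" for i
    using that assms by (auto simp: I_def)
  have "measure_pmf.prob ?M {f. \<forall>i\<in>I. \<not> separates f (2*i+1) (2*i+2) x y} =
    (\<Prod>i\<in>I. 1 - measure_pmf.prob ?M {f. separates f (2*i+1) (2*i+2) x y})"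
  proof (rule prob_Pi_pmf_Ball_not[where B = "\<lambda>i. block (2*i+1) (2*i+2) x y"])
    fix i j assume ij: "i \<in> I" "j \<in> I" "i \<noteq> j"
    \<comment> \<open>Every set in block \<open>i\<close> meets pair \<open>i\<close>, while every
      set in block \<open>j\<close> lies inside pair \<open>j\<close> together with \<open>x\<close>
      and \<open>y\<close>.\<close>
    have "{2*i+1, 2*i+2} \<inter> {2*j+1, 2*j+2, x, y} = {}"
    proof -
      have "2*i+1 \<noteq> 2*j+1" "2*i+1 \<noteq> 2*j+2" "2*i+2 \<noteq> 2*j+1" "2*i+2 \<noteq> 2*j+2"
        using ij(3) by presburger+
      moreover have "{2*i+1, 2*i+2} \<inter> {x, y} = {}" using ij(1) unfolding I_def by blast
      ultimately show ?thesis by blast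
    qed
    moreover have "e \<inter> {2*i+1, 2*i+2} \<noteq> {}" if "e \<in> block (2*i+1) (2*i+2) x y" for e
      using that by (auto simp: block_def)
    moreover have "e \<subseteq> {2*j+1, 2*j+2, x, y}" if "e \<in> block (2*j+1) (2*j+2) x y" for e
      using that by (auto simp: block_def)
    ultimately show "block (2*i+1) (2*i+2) x y \<inter> block (2*j+1) (2*j+2) x y = {}"
      by blast
  next
    fix i assume i: "i \<in> I"
    show "block (2*i+1) (2*i+2) x y \<subseteq> vertex_pairs n"
      using sub[OF i] by (auto simp: block_def doubleton_in_vertex_pairs)
    fix f g :: "nat set \<Rightarrow> bool"
    assume "\<And>e. e \<in> block (2*i+1) (2*i+2) x y \<Longrightarrow> f e = g e"
    then show "separates f (2*i+1) (2*i+2) x y = separates g (2*i+1) (2*i+2) x y"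
      by (simp add: separates_def block_def)
  qed simp_all
  also have "\<dots> = (\<Prod>i\<in>I. 1 - p ^ 3 * (1 - p) ^ 2)"
    by (intro prod.cong refl arg_cong2[where f = minus] prob_separates p sub)
  also have "\<dots> = (1 - p ^ 3 * (1 - p) ^ 2) ^ card I" by simp
  also have "\<dots> \<le> (1 - p ^ 3 * (1 - p) ^ 2) ^ (m - 2)"
    using card p by (intro power_decreasing) (auto intro!: mult_le_one power_le_one)
  also have "{f. \<forall>i\<in>I. \<not> separates f (2*i+1) (2*i+2) x y} =
    {f. \<forall>i<m. {2*i+1, 2*i+2} \<inter> {x, y} = {} \<longrightarrow> \<not> separates f (2*i+1) (2*i+2) x y}"
    by (auto simp: I_def)
  finally show ?thesis .
qed

text \<open>The number of edges among \<open>m\<close> disjoint pairs is binomial, so Hoeffding's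
  inequality applies.\<close>

lemma prob_many_edges:
  fixes m n :: nat and p \<epsilon> :: real
  assumes p: "0 \<le> p" "p \<le> 1" and m: "2 * m \<le> n" "0 < m" and "0 \<le> \<epsilon>"
  shows "measure_pmf.prob (Pi_pmf (vertex_pairs n) False (\<lambda>_. bernoulli_pmf p))
    {f. real (card {i. i < m \<and> f {2*i+1, 2*i+2}}) \<ge> m * p + \<epsilon>} \<le> exp (- 2 * \<epsilon>\<^sup>2 / m)"
proof -
  let ?E = "(\<lambda>i::nat. {2*i+1, 2*i+2}) ` {..<m}"
  have inj: "inj_on (\<lambda>i::nat. {2*i+1, 2*i+2}) S" for S
    by (auto simp: inj_on_def doubleton_eq_iff)
  have E: "?E \<subseteq> vertex_pairs n"
    using m by (auto simp: doubleton_in_vertex_pairs)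
  have card: "card {e \<in> ?E. f e} = card {i. i < m \<and> f {2*i+1, 2*i+2}}" for f
  proof -
    have "{e \<in> ?E. f e} = (\<lambda>i::nat. {2*i+1, 2*i+2}) ` {i. i < m \<and> f {2*i+1, 2*i+2}}"
      by auto
    then show ?thesis by (simp only: card_image[OF inj])
  qed
  \<comment> \<open>The binomial law is realised on the coordinates in \<open>?E\<close> alone, then
    transferred to all vertex pairs, of which \<open>?E\<close> is a marginal.\<close>
  have "binomial_pmf m p = map_pmf (\<lambda>f. card {e \<in> ?E. f e}) (Pi_pmf ?E False (\<lambda>_. bernoulli_pmf p))"
    using p by (intro binomial_pmf_altdef') (simp_all only: card_image[OF inj], auto)
  also have "Pi_pmf ?E False (\<lambda>_. bernoulli_pmf p) =
    map_pmf (\<lambda>f e. if e \<in> ?E then f e else False) (Pi_pmf (vertex_pairs n) False (\<lambda>_. bernoulli_pmf p))"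
    using E by (intro Pi_pmf_subset) auto
  also have "map_pmf (\<lambda>f. card {e \<in> ?E. f e}) \<dots> =
    map_pmf (\<lambda>f. card {e \<in> ?E. f e}) (Pi_pmf (vertex_pairs n) False (\<lambda>_. bernoulli_pmf p))"
    unfolding map_pmf_comp by (intro map_pmf_cong refl arg_cong[where f = card]) auto
  finally have "measure_pmf.prob (binomial_pmf m p) {k. real k \<ge> m * p + \<epsilon>} =
    measure_pmf.prob (Pi_pmf (vertex_pairs n) False (\<lambda>_. bernoulli_pmf p))
    {f. real (card {i. i < m \<and> f {2*i+1, 2*i+2}}) \<ge> m * p + \<epsilon>}"
    by (simp only: measure_map_pmf vimage_def mem_Collect_eq card)
  moreover have "measure_pmf.prob (binomial_pmf m p) {k. real k \<ge> m * p + \<epsilon>} \<le> exp (- 2 * \<epsilon>\<^sup>2 / m)"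
    by (rule binomial_distribution.prob_ge) (use assms in \<open>auto simp: binomial_distribution_def\<close>)
  ultimately show ?thesis by simp
qed

text \<open>A separating pair is itself an edge, so dropping the non-edges from the \<open>m\<close>
  pairs loses no separation and leaves only legal edge queries.\<close>

lemma eq_le_card_if_separating:
  fixes f :: "nat set \<Rightarrow> bool" and n :: nat
  defines "G \<equiv> ({1..n}, {e \<in> vertex_pairs n. f e})"
  assumes "0 < n" "2 * m \<le> n"
    and sep: "\<And>x y. x \<in> {1..n} \<Longrightarrow> y \<in> {1..n} \<Longrightarrow> x \<noteq> y \<Longrightarrow>
      \<exists>i<m. {2*i+1, 2*i+2} \<inter> {x, y} = {} \<and> separates f (2*i+1) (2*i+2) x y"
  shows "eq G \<le> enat (card {i. i < m \<and> f {2*i+1, 2*i+2}})"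
proof -
  let ?qs = "map (\<lambda>i. (2*i+1, 2*i+2)) (filter (\<lambda>i. f {2*i+1, 2*i+2}) [0..<m])"
  have "locatable_within (edge_queries G) G (length ?qs)"
  proof (rule locatable_within_nonadaptive)
    show "verts G \<noteq> {}" using assms by simp
    show "set ?qs \<subseteq> edge_queries G"
      using assms by (auto simp: edge_queries_def doubleton_in_vertex_pairs)
    fix x y assume xy: "x \<in> verts G" "y \<in> verts G" "x \<noteq> y"
    then obtain i where i: "i < m" "{2*i+1, 2*i+2} \<inter> {x, y} = {}" "separates f (2*i+1) (2*i+2) x y"
      using sep[of x y] by (auto simp: G_def)
    \<comment> \<open>\<open>f\<close> may hold on sets that are not vertex pairs; disjointness from
      \<open>{x, y}\<close> ensures that the three sets required to be edges are genuine
      pairs.\<close>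
    have "separates (\<lambda>e. e \<in> edges G) (2*i+1) (2*i+2) x y"
      using i xy assms by (auto simp: separates_def G_def doubleton_in_vertex_pairs)
    moreover have "{2*i+1, 2*i+2, x, y} \<subseteq> verts G" using i xy assms by auto
    ultimately have "gdist G (2*i+1) x < gdist G (2*i+2) x \<and> gdist G (2*i+2) y < gdist G (2*i+1) y"
      using i gdist_less_if_separates[of G "2*i+1" "2*i+2" x y] by auto
    moreover have "(2*i+1, 2*i+2) \<in> set ?qs" using i by (auto simp: separates_def)
    ultimately show "\<exists>(u, v) \<in> set ?qs. gdist G u x < gdist G v x \<and> gdist G v y < gdist G u y"
      by blast
  qed
  moreover have "length ?qs = card {i. i < m \<and> f {2*i+1, 2*i+2}}"
    by (simp add: length_filter_conv_card cong: conj_cong)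
  ultimately show ?thesis
    unfolding eq_def using query_number_le[of "edge_queries G" G "length ?qs"] by (simp only:)
qed

text \<open>Union bound: the bound on \<open>eq\<close> can fail only if too many of the
  \<open>m\<close> pairs are edges (\<open>K\<close>) or some ordered pair of distinct vertices is
  not separated (\<open>N\<close>).\<close>

lemma prob_eq_gt:
  fixes m n :: nat and p \<epsilon> :: real
  assumes p: "0 \<le> p" "p \<le> 1" and m: "2 * m \<le> n" "0 < m" and "0 \<le> \<epsilon>"
  shows "measure_pmf.prob (gnp n p) {G. \<not> ereal_of_enat (eq G) \<le> ereal (m * p + \<epsilon>)}
    \<le> exp (- 2 * \<epsilon>\<^sup>2 / m) + real n ^ 2 * (1 - p ^ 3 * (1 - p) ^ 2) ^ (m - 2)"
proof -
  let ?M = "Pi_pmf (vertex_pairs n) False (\<lambda>_. bernoulli_pmf p)"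
  define K where "K = {f. real (card {i. i < m \<and> f {2*i+1, 2*i+2}}) \<ge> m * p + \<epsilon>}"
  define N where "N = (\<lambda>(x, y). {f. \<forall>i<m. {2*i+1, 2*i+2} \<inter> {x, y} = {} \<longrightarrow>
    \<not> separates f (2*i+1) (2*i+2) x y})"
  define S where "S = {(x, y). x \<in> {1..n} \<and> y \<in> {1..n} \<and> x \<noteq> y}"
  have S: "S \<subseteq> {1..n} \<times> {1..n}" by (auto simp: S_def)
  then have fin: "finite S" by (rule finite_subset) auto
  have "card S \<le> card ({1..n} \<times> {1..n})" by (rule card_mono) (use S in auto)
  then have "card S \<le> n ^ 2" by (simp add: power2_eq_square)
  then have card: "real (card S) \<le> real n ^ 2" by (metis of_nat_le_iff of_nat_power)
  let ?c = "(1 - p ^ 3 * (1 - p) ^ 2) ^ (m - 2)"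
  have c: "0 \<le> ?c" using p by (auto intro!: zero_le_power mult_le_one power_le_one)
  have "{f. \<not> ereal_of_enat (eq ({1..n}, {e \<in> vertex_pairs n. f e})) \<le> ereal (m * p + \<epsilon>)}
      \<subseteq> K \<union> (\<Union>s\<in>S. N s)"
  proof (rule subsetI, rule ccontr)
    fix f assume *: "f \<in> {f. \<not> ereal_of_enat (eq ({1..n}, {e \<in> vertex_pairs n. f e})) \<le> ereal (m * p + \<epsilon>)}"
      "f \<notin> K \<union> (\<Union>s\<in>S. N s)"
    have "eq ({1..n}, {e \<in> vertex_pairs n. f e}) \<le> enat (card {i. i < m \<and> f {2*i+1, 2*i+2}})"
    proof (rule eq_le_card_if_separating)
      fix x y assume "x \<in> {1..n}" "y \<in> {1..n}" "x \<noteq> y"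
      then have "f \<notin> N (x, y)" using * by (auto simp: S_def)
      then show "\<exists>i<m. {2*i+1, 2*i+2} \<inter> {x, y} = {} \<and> separates f (2*i+1) (2*i+2) x y"
        unfolding N_def by blast
    qed (use m in auto)
    then have "ereal_of_enat (eq ({1..n}, {e \<in> vertex_pairs n. f e})) \<le>
        ereal_of_enat (enat (card {i. i < m \<and> f {2*i+1, 2*i+2}}))"
      by (simp only: ereal_of_enat_le_iff)
    also have "\<dots> \<le> ereal (m * p + \<epsilon>)" using * by (simp add: K_def)
    finally show False using * by simp
  qed
  then have "measure_pmf.prob (gnp n p) {G. \<not> ereal_of_enat (eq G) \<le> ereal (m * p + \<epsilon>)}
      \<le> measure_pmf.prob ?M (K \<union> (\<Union>s\<in>S. N s))"
    unfolding prob_gnp by (intro measure_pmf.finite_measure_mono) auto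
  also have "\<dots> \<le> measure_pmf.prob ?M K + measure_pmf.prob ?M (\<Union>s\<in>S. N s)"
    by (intro measure_Un_le) auto
  also have "measure_pmf.prob ?M (\<Union>s\<in>S. N s) \<le> (\<Sum>s\<in>S. measure_pmf.prob ?M (N s))"
    using fin by (intro measure_UNION_le) auto
  also have "\<dots> \<le> (\<Sum>s\<in>S. ?c)"
  proof (rule sum_mono)
    fix s assume "s \<in> S"
    then obtain x y where "s = (x, y)" "x \<in> {1..n}" "y \<in> {1..n}" "x \<noteq> y" by (auto simp: S_def)
    then show "measure_pmf.prob ?M (N s) \<le> ?c"
      using prob_no_separating_pair[OF p m(1), of x y] by (simp add: N_def)
  qed
  also have "\<dots> \<le> real n ^ 2 * ?c" using card c by (simp add: mult_right_mono)
  also have "measure_pmf.prob ?M K \<le> exp (- 2 * \<epsilon>\<^sup>2 / m)"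
    unfolding K_def by (rule prob_many_edges) (use assms in auto)
  finally show ?thesis by simp
qed

section \<open>Choice of parameters and passage to the limit\<close>

theorem theorem3p7:
  fixes p :: real
  assumes "0 < p" and "p < 1"
  shows "asymp_almost_surely (\<lambda>n. gnp n p)
           (\<lambda>n G. pq G \<le> eq G \<and>
              ereal_of_enat (eq G) \<le> ereal (3 / (p\<^sup>2 * (1 - p)\<^sup>2) * ln (real n)))
         \<and> (\<lambda>n. 3 / (p\<^sup>2 * (1 - p)\<^sup>2) * ln (real n)) \<in> O(\<lambda>n. ln (real n))"
proof
  define q where "q = p\<^sup>2 * (1 - p)\<^sup>2"
  have q: "0 < q" "p * q = p ^ 3 * (1 - p) ^ 2"
    using assms by (auto simp: q_def power2_eq_square power3_eq_cube)
  have pq: "0 < p * q" "p * q \<le> 1"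
    using assms q(1) unfolding q(2) by (auto intro!: mult_le_one power_le_one)
  \<comment> \<open>For \<open>m\<close> near \<open>c * ln n\<close>, the union bound over
    \<open>n^2\<close> choices wants \<open>c * p * q > 2\<close>, and an expected number
    \<open>m * p\<close> of queries below \<open>3 / q * ln n\<close> wants
    \<open>c * p * q < 3\<close>; the midpoint is taken.\<close>
  define c where "c = 5 / (2 * (p * q))"
  have c: "0 < c" using pq by (simp add: c_def)
  define m where "m n = nat \<lfloor>c * ln (real n)\<rfloor>" for n :: nat
  \<comment> \<open>The slack left for fluctuations:
    \<open>3 / q - 5 / (2 * q) = 1 / (2 * q)\<close>.\<close>
  define \<epsilon> where "\<epsilon> n = ln (real n) / (2 * q)" for n :: nat
  let ?P = "\<lambda>n. measure_pmf.prob (gnp n p) {G. \<not> ereal_of_enat (eq G) \<le> ereal (3 / q * ln (real n))}"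
  let ?b = "\<lambda>n. exp (- (p / (5 * q)) * ln (real n)) + exp 3 * exp (- (1/2) * ln (real n))"
  \<comment> \<open>The first condition gives \<open>m n > 0\<close>, the second leaves room for
    \<open>m n\<close> disjoint pairs, the third makes the logarithm positive.\<close>
  have bound: "?P n \<le> ?b n"
    if n: "c * ln (real n) \<ge> 1" "2 * (c * ln (real n)) \<le> real n" "n \<ge> 2" for n
  proof -
    let ?L = "ln (real n)"
    have L: "?L > 0" using n by simp
    have m: "real (m n) \<le> c * ?L" "c * ?L - 1 < real (m n)" "0 < m n"
      using n by (auto simp: m_def)
    have mp: "m n * p + \<epsilon> n \<le> 3 / q * ?L"
    proof -
      have "m n * p \<le> c * ?L * p" using m assms by (intro mult_right_mono) auto
      also have "\<dots> = 5 / (2 * q) * ?L" using assms q(1) by (simp add: c_def)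
      finally have "m n * p + \<epsilon> n \<le> 5 / (2 * q) * ?L + ?L / (2 * q)" by (simp add: \<epsilon>_def)
      also have "\<dots> = 3 / q * ?L" using q(1) by (simp add: field_simps)
      finally show ?thesis .
    qed
    have "?P n \<le> measure_pmf.prob (gnp n p) {G. \<not> ereal_of_enat (eq G) \<le> ereal (m n * p + \<epsilon> n)}"
      using mp by (intro measure_pmf.finite_measure_mono) (auto intro: order.trans)
    also have "\<dots> \<le> exp (- 2 * (\<epsilon> n)\<^sup>2 / m n) + real n ^ 2 * (1 - p * q) ^ (m n - 2)"
      unfolding q(2) using assms m n L q(1) by (intro prob_eq_gt) (auto simp: \<epsilon>_def)
    also have "exp (- 2 * (\<epsilon> n)\<^sup>2 / m n) \<le> exp (- (p / (5 * q)) * ?L)"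
    proof -
      \<comment> \<open>Hoeffding's exponent with \<open>m n\<close> replaced by its upper bound
        \<open>c * ?L\<close>.\<close>
      have "p / (5 * q) * ?L = 2 * (\<epsilon> n)\<^sup>2 / (c * ?L)"
        using assms q(1) L by (simp add: \<epsilon>_def c_def field_simps power2_eq_square)
      also have "\<dots> \<le> 2 * (\<epsilon> n)\<^sup>2 / m n"
        using m by (intro divide_left_mono) auto
      finally show ?thesis by simp
    qed
    also have "real n ^ 2 * (1 - p * q) ^ (m n - 2) \<le> exp 3 * exp (- (1/2) * ?L)"
    proof -
      have "(1 - p * q) ^ (m n - 2) \<le> exp (- (p * q)) ^ (m n - 2)"
        using pq exp_ge_add_one_self[of "- (p * q)"] by (intro power_mono) auto
      also have "\<dots> = exp (- (p * q) * real (m n - 2))"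
        by (simp add: exp_of_nat_mult[symmetric] mult.commute)
      \<comment> \<open>Rounding \<open>m n\<close> down costs less than 1 and the two spoiled pairs
        cost 2, hence the 3; it becomes the constant factor \<open>exp 3\<close> since
        \<open>p * q \<le> 1\<close>.\<close>
      also have "\<dots> \<le> exp (- (p * q) * (c * ?L - 3))"
        using pq m(2) by (auto intro!: mult_left_mono)
      also have "- (p * q) * (c * ?L - 3) = - (5/2) * ?L + 3 * (p * q)"
        using assms q(1) by (simp add: c_def field_simps)
      also have "exp \<dots> \<le> exp (- (5/2) * ?L + 3)" using pq by simp
      finally have *: "real n ^ 2 * (1 - p * q) ^ (m n - 2) \<le> real n ^ 2 * exp (- (5/2) * ?L + 3)"
        by (intro mult_left_mono) auto
      have "real n ^ 2 = exp (2 * ?L)"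
        using n by (simp add: exp_double)
      then have "real n ^ 2 * exp (- (5/2) * ?L + 3) = exp 3 * exp (- (1/2) * ?L)"
        by (simp add: exp_add[symmetric])
      with * show ?thesis by simp
    qed
    finally show ?thesis by simp
  qed
  have "eventually (\<lambda>n. c * ln (real n) \<ge> 1) sequentially"
    using c by real_asymp
  moreover have "eventually (\<lambda>n. 2 * (c * ln (real n)) \<le> real n) sequentially"
    using c by real_asymp
  ultimately have ev: "eventually (\<lambda>n. ?P n \<le> ?b n) sequentially"
    using eventually_ge_at_top[of 2] by eventually_elim (rule bound)
  have "(\<lambda>n::nat. exp (- a * ln (real n)) + exp 3 * exp (- (1/2) * ln (real n))) \<longlonglongrightarrow> 0"
    if "a > 0" for a :: real
  proof -
    have *: "(\<lambda>n::nat. exp (- b * ln (real n))) \<longlonglongrightarrow> 0" if "b > 0" for b :: real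
    proof (rule filterlim_compose[OF exp_at_bot])
      show "filterlim (\<lambda>n::nat. - b * ln (real n)) at_bot sequentially"
        using that by real_asymp
    qed
    show ?thesis using tendsto_add[OF *[OF that] tendsto_mult_left[OF *[of "1/2"], of "exp 3"]] by simp
  qed
  from this[of "p / (5 * q)"] have "?b \<longlonglongrightarrow> 0" using assms q(1) by simp
  then have "?P \<longlonglongrightarrow> 0"
    by (intro tendsto_sandwich[OF _ ev tendsto_const]) auto
  then have "(\<lambda>n. 1 - ?P n) \<longlonglongrightarrow> 1 - 0" by (intro tendsto_diff tendsto_const)
  \<comment> \<open>The comparison of \<open>pq\<close> with \<open>eq\<close> holds for every
    graph, so it does not change the event.\<close>
  moreover have "1 - ?P n = measure_pmf.prob (gnp n p)
      {G. pq G \<le> eq G \<and> ereal_of_enat (eq G) \<le> ereal (3 / q * ln (real n))}" for n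
    using measure_pmf.prob_compl[of "{G. ereal_of_enat (eq G) \<le> ereal (3 / q * ln (real n))}" "gnp n p"]
    by (simp add: pq_le_eq Compl_eq_Diff_UNIV[symmetric] Collect_neg_eq)
  ultimately show "asymp_almost_surely (\<lambda>n. gnp n p)
           (\<lambda>n G. pq G \<le> eq G \<and>
              ereal_of_enat (eq G) \<le> ereal (3 / (p\<^sup>2 * (1 - p)\<^sup>2) * ln (real n)))"
    by (simp add: asymp_almost_surely_def q_def)
  show "(\<lambda>n. 3 / (p\<^sup>2 * (1 - p)\<^sup>2) * ln (real n)) \<in> O(\<lambda>n. ln (real n))"
    by (rule bigoI[of _ "\<bar>3 / (p\<^sup>2 * (1 - p)\<^sup>2)\<bar>"]) (simp add: abs_mult)
qed

end
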